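(* Let $(J,\mathcal{B},\eta)$ be a Markov space and let $G=(V,E)$ be a finite simple triangle-free graph. If there is a normalized, decreasing and Markovian family $(\mu_S : S\subseteq V)$ of measures on the induced subgraphs of $G$ (with $\mu_S$ a sigma-finite measure on $(J^S,\mathcal{B}^S)$), then this family is uniquely determined; that is, any two normalized, decreasing and Markovian families $(\mu_S)_{S\subseteq V}$ and $(\mu'_S)_{S\subseteq V}$ satisfy $\mu_S=\mu'_S$ for every $S\subseteq V$.
   Context: A Markov space $(J,\mathcal{B},\eta)$ is a standard Borel space $(J,\mathcal{B})$ with a probability measure $\eta$ on $\mathcal{B}\times\mathcal{B}$ that is symmetric ($\eta(A\times B)=\eta(B\times A)$). Its marginal is $\pi(A)=\eta(A\times J)$. For a finite set $S$, $\mathcal{B}^S$ denotes the product sigma-algebra on $J^S$. Let $G=(V,E)$ be a finite simple graph, and $(\mu_S:S\subseteq V)$ a family of sigma-finite measures, $\mu_S$ on $(J^S,\mathcal{B}^S)$ (we think of $\mu_S$ as a measure $\eta^{G[S]}$ assigned to the induced subgraph $G[S]$). - The family is decreasing if for all $S\subseteq T\subseteq V$ the marginal of $\mu_T$ on $J^S$ is absolutely continuous with respect to $\mu_S$. In this case, there is a measurable family $(\nu_{S,T,x}:x\in J^S)$ of measures on $\mathcal{B}^{T\setminus S}$ (unique up to changes for $x$ in a $\mu_S$-null set) such that $\mu_T(A\times B)=\int_A \nu_{S,T,x}(B)\,d\mu_S(x)$ for $A\in\mathcal{B}^S$, $B\in\mathcal{B}^{T\setminus S}$. - The family is Markovian (with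 respect to $G$) if it is decreasing, and for any $U,W\subseteq V$ with $S=U\cap W$ such that no edge of $G$ connects $U\setminus S$ and $W\setminus S$, we have $\nu_{S,U\cup W,x}=\nu_{S,U,x}\times\nu_{S,W,x}$ for $\mu_S$-almost all $x\in J^S$. - The family is normalized if $\mu_S=\pi$ whenever $|S|=1$, $\mu_S=\eta$ whenever $S=\{i,j\}$ with $ij\in E$, and $\mu_\emptyset$ is the unit mass on the one-point space $J^\emptyset$. *)

theory Defs
  imports "HOL-Probability.Probability"
begin

definition standard_Borel :: "'a measure \<Rightarrow> bool" where
  "standard_Borel J \<longleftrightarrow>
     (\<exists>X. completely_metrizable_space X \<and> second_countable X \<and>
          sets J = sets (sigma (topspace X) {U. openin X U}))"

text \<open>
  The first argument \<open>J\<close> represents the measurable space \<open>(J, \<B>)\<close>; only \<open>space J\<close> and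
  \<open>sets J\<close> are ever used, never the measure that \<open>J\<close> carries as a value of type \<open>measure\<close>.
\<close>

definition markov_space :: "'a measure \<Rightarrow> ('a \<times> 'a) measure \<Rightarrow> bool" where
  "markov_space J \<eta> \<longleftrightarrow>
     standard_Borel J \<and> prob_space \<eta> \<and> sets \<eta> = sets (J \<Otimes>\<^sub>M J) \<and>
     (\<forall>A\<in>sets J. \<forall>B\<in>sets J. emeasure \<eta> (A \<times> B) = emeasure \<eta> (B \<times> A))"

definition marginal :: "'a measure \<Rightarrow> ('a \<times> 'a) measure \<Rightarrow> 'a measure" where
  "marginal J \<eta> = distr \<eta> J fst"

definition simple_graph :: "'v set \<Rightarrow> 'v set set \<Rightarrow> bool" where
  "simple_graph V E \<longleftrightarrow> finite V \<and> (\<forall>e\<in>E. e \<subseteq> V \<and> card e = 2)"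

definition triangle_free :: "'v set set \<Rightarrow> bool" where
  "triangle_free E \<longleftrightarrow> \<not> (\<exists>u v w. {u, v} \<in> E \<and> {v, w} \<in> E \<and> {u, w} \<in> E)"

text \<open>
  \<open>pow J S\<close> is the measurable space \<open>(J\<^sup>S, \<B>\<^sup>S)\<close>; its points are the functions that are
  \<open>undefined\<close> outside \<open>S\<close>.
\<close>

abbreviation pow :: "'a measure \<Rightarrow> 'v set \<Rightarrow> ('v \<Rightarrow> 'a) measure" where
  "pow J S \<equiv> PiM S (\<lambda>_. J)"

definition measure_family :: "'a measure \<Rightarrow> 'v set \<Rightarrow> ('v set \<Rightarrow> ('v \<Rightarrow> 'a) measure) \<Rightarrow> bool" where
  "measure_family J V \<mu> \<longleftrightarrow>
     (\<forall>S. S \<subseteq> V \<longrightarrow> sets (\<mu> S) = sets (pow J S) \<and> sigma_finite_measure (\<mu> S))"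

definition decreasing :: "'a measure \<Rightarrow> 'v set \<Rightarrow> ('v set \<Rightarrow> ('v \<Rightarrow> 'a) measure) \<Rightarrow> bool" where
  "decreasing J V \<mu> \<longleftrightarrow>
     (\<forall>S T. S \<subseteq> T \<longrightarrow> T \<subseteq> V \<longrightarrow>
        absolutely_continuous (\<mu> S) (distr (\<mu> T) (pow J S) (\<lambda>z. restrict z S)))"

text \<open>
  \<open>disintegrates J S T \<mu>S \<mu>T \<nu>\<close>: \<open>\<nu>\<close> is a measurable family \<open>(\<nu>\<^sub>S\<^sub>,\<^sub>T\<^sub>,\<^sub>x : x \<in> J\<^sup>S)\<close> of measures on
  \<open>\<B>\<^bsup>T - S\<^esup>\<close> with \<open>\<mu>T (A \<times> B) = \<integral>\<^sub>A \<nu>\<^sub>S\<^sub>,\<^sub>T\<^sub>,\<^sub>x(B) d\<mu>S(x)\<close>. The set of functions \<open>z\<close> below is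
  \<open>A \<times> B\<close> under the identification of \<open>J\<^sup>S \<times> J\<^bsup>T - S\<^esup>\<close> with \<open>J\<^sup>T\<close>.
\<close>

definition disintegrates ::
  "'a measure \<Rightarrow> 'v set \<Rightarrow> 'v set \<Rightarrow> ('v \<Rightarrow> 'a) measure \<Rightarrow> ('v \<Rightarrow> 'a) measure \<Rightarrow>
   (('v \<Rightarrow> 'a) \<Rightarrow> ('v \<Rightarrow> 'a) measure) \<Rightarrow> bool" where
  "disintegrates J S T \<mu>S \<mu>T \<nu> \<longleftrightarrow>
     (\<forall>x\<in>space (pow J S). sets (\<nu> x) = sets (pow J (T - S))) \<and>
     (\<forall>B\<in>sets (pow J (T - S)). (\<lambda>x. emeasure (\<nu> x) B) \<in> borel_measurable (pow J S)) \<and>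
     (\<forall>A\<in>sets (pow J S). \<forall>B\<in>sets (pow J (T - S)).
        emeasure \<mu>T {z \<in> space (pow J T). restrict z S \<in> A \<and> restrict z (T - S) \<in> B} =
        (\<integral>\<^sup>+x\<in>A. emeasure (\<nu> x) B \<partial>\<mu>S))"

text \<open>
  \<open>prod_on J P Q \<alpha> \<beta>\<close> is the product measure \<open>\<alpha> \<times> \<beta>\<close>, for \<open>\<alpha>\<close> on \<open>J\<^sup>P\<close> and \<open>\<beta>\<close> on \<open>J\<^sup>Q\<close> with
  \<open>P\<close>, \<open>Q\<close> disjoint, viewed as a measure on \<open>J\<^bsup>P \<union> Q\<^esup>\<close>.
\<close>

definition prod_on ::
  "'a measure \<Rightarrow> 'v set \<Rightarrow> 'v set \<Rightarrow> ('v \<Rightarrow> 'a) measure \<Rightarrow> ('v \<Rightarrow> 'a) measure \<Rightarrow>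
   ('v \<Rightarrow> 'a) measure" where
  "prod_on J P Q \<alpha> \<beta> = distr (\<alpha> \<Otimes>\<^sub>M \<beta>) (pow J (P \<union> Q)) (merge P Q)"

text \<open>
  For a decreasing family of sigma-finite measures on powers of a standard Borel space the
  disintegrations \<open>\<nu> S T\<close> exist and are unique almost everywhere, so it does not matter which
  version is chosen; the definition asks for the Markov identities for some choice of versions.
\<close>

definition markovian ::
  "'a measure \<Rightarrow> 'v set \<Rightarrow> 'v set set \<Rightarrow> ('v set \<Rightarrow> ('v \<Rightarrow> 'a) measure) \<Rightarrow> bool" where
  "markovian J V E \<mu> \<longleftrightarrow>
     decreasing J V \<mu> \<and>
     (\<exists>\<nu>. (\<forall>S T. S \<subseteq> T \<longrightarrow> T \<subseteq> V \<longrightarrow> disintegrates J S T (\<mu> S) (\<mu> T) (\<nu> S T)) \<and>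
       (\<forall>U W S. U \<subseteq> V \<longrightarrow> W \<subseteq> V \<longrightarrow> S = U \<inter> W \<longrightarrow>
          (\<forall>u\<in>U - S. \<forall>w\<in>W - S. {u, w} \<notin> E) \<longrightarrow>
          (AE x in \<mu> S. \<nu> S (U \<union> W) x = prod_on J (U - S) (W - S) (\<nu> S U x) (\<nu> S W x))))"

text \<open>
  The maps \<open>z \<mapsto> z i\<close> and \<open>z \<mapsto> (z i, z j)\<close> identify \<open>J\<^bsup>{i}\<^esup>\<close> with \<open>J\<close> and \<open>J\<^bsup>{i, j}\<^esup>\<close> with
  \<open>J \<times> J\<close>; the only point of \<open>J\<^bsup>{}\<^esup>\<close> is \<open>\<lambda>_. undefined\<close>.
\<close>

definition normalized ::
  "'a measure \<Rightarrow> ('a \<times> 'a) measure \<Rightarrow> 'v set \<Rightarrow> 'v set set \<Rightarrow>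
   ('v set \<Rightarrow> ('v \<Rightarrow> 'a) measure) \<Rightarrow> bool" where
  "normalized J \<eta> V E \<mu> \<longleftrightarrow>
     (\<forall>i\<in>V. distr (\<mu> {i}) J (\<lambda>z. z i) = marginal J \<eta>) \<and>
     (\<forall>i j. {i, j} \<in> E \<longrightarrow> distr (\<mu> {i, j}) (J \<Otimes>\<^sub>M J) (\<lambda>z. (z i, z j)) = \<eta>) \<and>
     \<mu> {} = return (pow J {}) (\<lambda>_. undefined)"

end

theory Submission
  imports Defs
begin

text \<open>
  A clique of a triangle-free graph has at most two vertices, so on a clique the measure is
  prescribed by normalization (\<open>clique_unique\<close>). Any other vertex set \<open>T\<close> contains
  nonadjacent \<open>i \<noteq> j\<close>. With \<open>C = T - {i, j}\<close>, the Markov property for \<open>U = C \<union> {i}\<close> and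
  \<open>W = C \<union> {j}\<close> says that the fibres of \<open>\<mu> T\<close> over \<open>J\<^sup>C\<close> are products of the fibres of \<open>\<mu> U\<close>
  and of \<open>\<mu> W\<close>; hence \<open>\<mu> T\<close> is determined by \<open>\<mu> C\<close>, \<open>\<mu> U\<close> and \<open>\<mu> W\<close>
  (\<open>markov_step_unique\<close>), and uniqueness follows by induction on \<open>T\<close>.

  The difficulty is that the measures may be infinite. The identity that characterizes a
  disintegration only speaks about rectangles \<open>A \<times> B\<close> with \<open>A \<subseteq> J\<^sup>S\<close>,
  \<open>B \<subseteq> J\<^bsup>T - S\<^esup>\<close>. A sigma-finite measure can be infinite on every rectangle of positive
  measure; then it is not determined by its values on rectangles, and \<open>\<nu> S T x\<close> may have
  infinite mass on sets where the conditional measure is finite. So it has to be shown that the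
  relevant fibres are finite almost everywhere. The property \<open>finite_fibres S T\<close> expresses this;
  it is equivalent to sigma-finiteness of the marginal of \<open>\<mu> T\<close> on \<open>J\<^sup>S\<close>, and so does not
  depend on the version of the disintegration.

  The core of the proof is \<open>finite_fibres_insert\<close>: adding one vertex \<open>i\<close> to any set \<open>C\<close> gives
  finite fibres over \<open>J\<^sup>C\<close>. Let \<open>N\<close> be the set of neighbours of \<open>i\<close> in \<open>C\<close> and \<open>D = C - N\<close>.

  \<^item> The graph on \<open>N \<union> {i}\<close> is a star, because \<open>N\<close> is independent. Over its centre, the fibres
    of \<open>\<mu> (N \<union> {i})\<close> are products of fibres of edge measures, which are probability measures.
    So \<open>\<mu> (N \<union> {i})\<close> is finite, and its fibres over \<open>J\<^sup>N\<close> have a finite mass \<open>f\<close>.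

  \<^item> By the Markov property for \<open>C\<close> and \<open>N \<union> {i}\<close>, the marginal of \<open>\<mu> (C \<union> {i})\<close> on \<open>J\<^sup>C\<close>
    agrees with \<open>f(x\<^bsub>N\<^esub>) d\<mu>\<^bsub>C\<^esub>(x)\<close> on the rectangles of \<open>J\<^sup>N \<times> J\<^sup>D\<close>. If rectangles determine this
    measure, \<open>f(x\<^bsub>N\<^esub>)\<close> is its density with respect to \<open>\<mu> C\<close>, that is, the mass of the fibre over \<open>x\<close>.

  \<^item> They do determine it, because \<open>\<mu> C\<close> has finite fibres over \<open>J\<^sup>D\<close>: the vertices of the
    independent set \<open>N\<close> can be added to \<open>D\<close> separately, and for each of them the fibres over
    \<open>J\<^sup>D\<close> are finite by induction on the size of \<open>C\<close>.
\<close>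

section \<open>Measures determined by boxes and rectangles\<close>

lemma measure_eq_if_image_eq:
  assumes "f \<in> M \<rightarrow>\<^sub>M K" and "g \<in> K \<rightarrow>\<^sub>M M" and "\<And>x. x \<in> space M \<Longrightarrow> g (f x) = x"
    and "sets M' = sets M" and "distr M K f = distr M' K f"
  shows "M = M'"
proof -
  have f': "f \<in> M' \<rightarrow>\<^sub>M K"
    using assms(1) measurable_cong_sets[OF assms(4) refl] by blast
  have id: "distr (distr N K f) M g = N" if "sets N = sets M" "f \<in> N \<rightarrow>\<^sub>M K" for N
  proof -
    have "distr (distr N K f) M g = distr N M (g \<circ> f)"
      by (rule distr_distr[OF assms(2) that(2)])
    also have "\<dots> = distr N N (\<lambda>x. x)"
      using that(1) sets_eq_imp_space_eq[OF that(1)] assms(3) by (intro distr_cong) auto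
    finally show ?thesis by (simp add: distr_id2[symmetric])
  qed
  show ?thesis
    using id[OF refl assms(1)] id[OF assms(4) f'] assms(5) by metis
qed

text \<open>
  The usual uniqueness theorem for measures on a product needs a cover by boxes of finite measure.
  Here the cover may consist of any measurable sets; the price is that agreement is required on
  their intersections with boxes, so that the usual theorem applies to the restrictions of both
  measures to each set of the cover.
\<close>

lemma measure_eq_if_eq_on_boxes:
  assumes "finite I" and P: "sets P = sets (PiM I M)" and Q: "sets Q = sets (PiM I M)"
    and R: "\<And>n::nat. R n \<in> sets (PiM I M)" and cover: "(\<Union>n. R n) = space (PiM I M)"
    and fin: "\<And>n. emeasure P (R n) \<noteq> \<infinity>"
    and eq: "\<And>n F. (\<And>i. i \<in> I \<Longrightarrow> F i \<in> sets (M i)) \<Longrightarrow>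
      emeasure P (R n \<inter> Pi\<^sub>E I F) = emeasure Q (R n \<inter> Pi\<^sub>E I F)"
  shows "P = Q"
proof -
  have dens: "density P (indicator (R n)) = density Q (indicator (R n))" for n
  proof (rule measure_eqI_PiM_finite[where A = "\<lambda>_. space (PiM I M)"])
    show "finite I" by fact
    show "sets (density P (indicator (R n))) = sets (PiM I M)"
      "sets (density Q (indicator (R n))) = sets (PiM I M)"
      using P Q by auto
    show "emeasure (density P (indicator (R n))) (Pi\<^sub>E I F)
        = emeasure (density Q (indicator (R n))) (Pi\<^sub>E I F)"
      if "\<And>i. i \<in> I \<Longrightarrow> F i \<in> sets (M i)" for F
    proof -
      have "Pi\<^sub>E I F \<in> sets (PiM I M)"
        using that \<open>finite I\<close> by (intro sets_PiM_I_finite) auto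
      then show ?thesis
        using eq[where n=n and F=F] that R[of n] P Q
        by (simp add: emeasure_restricted)
    qed
    show "range (\<lambda>_. space (PiM I M)) \<subseteq> prod_algebra I M"
      using \<open>finite I\<close> by (auto simp: space_PiM intro!: prod_algebraI_finite)
    show "emeasure (density P (indicator (R n))) (space (PiM I M)) \<noteq> \<infinity>"
      using fin[of n] R[of n] P sets_eq_imp_space_eq[OF P] sets.sets_into_space[OF R[of n]]
      by (simp add: emeasure_restricted Int_absorb2)
  qed auto
  show ?thesis
  proof (rule measure_eqI)
    show "sets P = sets Q" using P Q by simp
    fix Z assume Z: "Z \<in> sets P"
    define D where "D = (\<lambda>n. Z \<inter> disjointed R n)"
    have D: "D n \<in> sets P" for n
      using Z R P sets.range_disjointed_sets[of R P] unfolding D_def by (auto simp: image_subset_iff)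
    have DZ: "Z = (\<Union>n. D n)"
      using cover sets.sets_into_space[OF Z] sets_eq_imp_space_eq[OF P]
      unfolding D_def Int_UN_distrib[symmetric] UN_disjointed_eq by blast
    have disj: "disjoint_family D"
      using disjoint_family_disjointed[of R] unfolding D_def disjoint_family_on_def by blast
    have "emeasure P (D n) = emeasure Q (D n)" for n
    proof -
      have "R n \<inter> D n = D n"
        using disjointed_subset[of R n] by (auto simp: D_def)
      moreover have "emeasure (density P (indicator (R n))) (D n)
          = emeasure (density Q (indicator (R n))) (D n)"
        by (simp add: dens)
      ultimately show ?thesis
        using D[of n] R[of n] P Q by (simp add: emeasure_restricted)
    qed
    then have "(\<Sum>n. emeasure P (D n)) = (\<Sum>n. emeasure Q (D n))" by simp
    then show "emeasure P Z = emeasure Q Z"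
      using D P Q disj by (simp add: suminf_emeasure DZ[symmetric] image_subset_iff)
  qed
qed

lemma measurable_restrict_pow:
  assumes "S \<subseteq> T" and "sets N = sets (pow J T)"
  shows "(\<lambda>z. restrict z S) \<in> N \<rightarrow>\<^sub>M pow J S"
  using measurable_restrict_subset[OF assms(1)] measurable_cong_sets[OF assms(2) refl] by blast

lemma restrict_in_space_pow:
  assumes "S \<subseteq> T" and "z \<in> space (pow J T)"
  shows "restrict z S \<in> space (pow J S)"
  using measurable_space[OF measurable_restrict_subset[OF assms(1)] assms(2)] .

lemma rectangle_in_sets_pow:
  assumes "S \<subseteq> T" and "S' \<subseteq> T" and "A \<in> sets (pow J S)" and "B \<in> sets (pow J S')"
  shows "{z \<in> space (pow J T). restrict z S \<in> A \<and> restrict z S' \<in> B} \<in> sets (pow J T)"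
proof -
  have "((\<lambda>z. restrict z S) -` A \<inter> space (pow J T)) \<inter> ((\<lambda>z. restrict z S') -` B \<inter> space (pow J T))
      \<in> sets (pow J T)"
    using assms by (intro sets.Int measurable_sets[OF measurable_restrict_subset])
  also have "((\<lambda>z. restrict z S) -` A \<inter> space (pow J T)) \<inter> ((\<lambda>z. restrict z S') -` B \<inter> space (pow J T))
      = {z \<in> space (pow J T). restrict z S \<in> A \<and> restrict z S' \<in> B}" by auto
  finally show ?thesis .
qed

lemma box_Int_rectangle:
  assumes "\<And>k. k \<in> S \<union> S' \<Longrightarrow> F k \<subseteq> space J" and "T = S \<union> S'"
  shows "{z \<in> space (pow J T). restrict z S \<in> A \<and> restrict z S' \<in> B} \<inter> Pi\<^sub>E T F
    = {z \<in> space (pow J T). restrict z S \<in> A \<inter> Pi\<^sub>E S F \<and> restrict z S' \<in> B \<inter> Pi\<^sub>E S' F}"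
  using assms(1) unfolding assms(2) by (auto simp: space_PiM PiE_iff extensional_def)

lemma disintegrates_measurable:
  assumes "disintegrates J S T M N \<nu>" and M: "sets M = sets (pow J S)"
    and "B \<in> sets (pow J (T - S))"
  shows "(\<lambda>x. emeasure (\<nu> x) B) \<in> borel_measurable M"
  using assms(1,3) measurable_cong_sets[OF M refl] unfolding disintegrates_def by blast

lemma disintegrates_rectangle:
  assumes "disintegrates J S T M N \<nu>"
    and "A \<in> sets (pow J S)" and "B \<in> sets (pow J (T - S))"
  shows "emeasure N {z \<in> space (pow J T). restrict z S \<in> A \<and> restrict z (T - S) \<in> B}
    = (\<integral>\<^sup>+x\<in>A. emeasure (\<nu> x) B \<partial>M)"
  using assms unfolding disintegrates_def by blast

text \<open>
  For fixed \<open>B\<close>, the defining identity says that two measures on \<open>J\<^sup>S\<close> are equal: the marginal of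
  \<open>N\<close> restricted to \<open>{z. z\<^bsub>T - S\<^esub> \<in> B}\<close>, and the measure with density \<open>\<nu> x B\<close>. Thus it extends
  from indicators of sets \<open>A\<close> to all nonnegative \<open>g\<close>.
\<close>

lemma disintegrates_nn_integral:
  assumes d: "disintegrates J S T M N \<nu>" and "S \<subseteq> T"
    and M: "sets M = sets (pow J S)" and N: "sets N = sets (pow J T)"
    and B: "B \<in> sets (pow J (T - S))" and g: "g \<in> borel_measurable (pow J S)"
  shows "(\<integral>\<^sup>+z. g (restrict z S) * indicator B (restrict z (T - S)) \<partial>N)
    = (\<integral>\<^sup>+x. g x * emeasure (\<nu> x) B \<partial>M)"
proof -
  note r1 = measurable_restrict_pow[OF \<open>S \<subseteq> T\<close> N]
  have r2: "(\<lambda>z. restrict z (T - S)) \<in> N \<rightarrow>\<^sub>M pow J (T - S)"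
    by (rule measurable_restrict_pow[OF _ N]) auto
  have ind: "(\<lambda>z. indicator B (restrict z (T - S)) :: ennreal) \<in> borel_measurable N"
    using r2 B by measurable
  have nu: "(\<lambda>x. emeasure (\<nu> x) B) \<in> borel_measurable M"
    by (rule disintegrates_measurable[OF d M B])
  have g': "g \<in> borel_measurable M"
    using g measurable_cong_sets[OF M refl] by blast
  have slice: "distr (density N (\<lambda>z. indicator B (restrict z (T - S)))) (pow J S) (\<lambda>z. restrict z S)
      = density M (\<lambda>x. emeasure (\<nu> x) B)" (is "?L = ?R")
  proof (rule measure_eqI)
    show "sets ?L = sets ?R" using M by simp
    fix A assume "A \<in> sets ?L"
    then have A: "A \<in> sets (pow J S)" by simp
    have "emeasure ?L A = (\<integral>\<^sup>+z. indicator B (restrict z (T - S))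
        * indicator ((\<lambda>z. restrict z S) -` A \<inter> space N) z \<partial>N)"
      using A r1 ind by (simp add: emeasure_distr emeasure_density)
    also have "\<dots> = (\<integral>\<^sup>+z. indicator {z \<in> space (pow J T). restrict z S \<in> A \<and> restrict z (T - S) \<in> B} z \<partial>N)"
      using sets_eq_imp_space_eq[OF N]
      by (intro nn_integral_cong) (auto split: split_indicator)
    also have "\<dots> = emeasure N {z \<in> space (pow J T). restrict z S \<in> A \<and> restrict z (T - S) \<in> B}"
    proof (rule nn_integral_indicator)
      show "{z \<in> space (pow J T). restrict z S \<in> A \<and> restrict z (T - S) \<in> B} \<in> sets N"
        unfolding N using \<open>S \<subseteq> T\<close> A B by (intro rectangle_in_sets_pow) auto
    qed
    also have "\<dots> = (\<integral>\<^sup>+x\<in>A. emeasure (\<nu> x) B \<partial>M)"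
      by (rule disintegrates_rectangle[OF d A B])
    also have "\<dots> = emeasure ?R A"
      using A M nu by (simp add: emeasure_density)
    finally show "emeasure ?L A = emeasure ?R A" .
  qed
  have "(\<integral>\<^sup>+z. g (restrict z S) * indicator B (restrict z (T - S)) \<partial>N) = (\<integral>\<^sup>+x. g x \<partial>?L)"
    using g r1 ind
    by (simp add: nn_integral_distr nn_integral_density measurable_compose[OF r1 g] mult.commute)
  also have "\<dots> = (\<integral>\<^sup>+x. g x * emeasure (\<nu> x) B \<partial>M)"
    unfolding slice using nu g' by (simp add: nn_integral_density mult.commute)
  finally show ?thesis .
qed

text \<open>
  Both sides are densities of the same measure with respect to the sigma-finite measure \<open>M\<close>, and
  such densities are unique even where they are infinite. The exceptional null set depends on \<open>B\<close>;
  equality of the measures \<open>\<nu> x\<close> and \<open>\<nu>' x\<close> almost everywhere would need more.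
\<close>

lemma disintegrates_unique:
  assumes "sigma_finite_measure M"
    and M: "sets M = sets (pow J S)" and "B \<in> sets (pow J (T - S))"
    and "disintegrates J S T M N \<nu>" and "disintegrates J S T M N \<nu>'"
  shows "AE x in M. emeasure (\<nu> x) B = emeasure (\<nu>' x) B"
proof (rule sigma_finite_measure.density_unique2[OF assms(1)])
  show "(\<lambda>x. emeasure (\<nu> x) B) \<in> borel_measurable M" "(\<lambda>x. emeasure (\<nu>' x) B) \<in> borel_measurable M"
    using disintegrates_measurable assms by blast+
  fix A assume "A \<in> sets M"
  then have A: "A \<in> sets (pow J S)" using M by simp
  show "(\<integral>\<^sup>+x\<in>A. emeasure (\<nu> x) B \<partial>M) = (\<integral>\<^sup>+x\<in>A. emeasure (\<nu>' x) B \<partial>M)"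
    using disintegrates_rectangle[OF assms(4) A assms(3)]
      disintegrates_rectangle[OF assms(5) A assms(3)] by simp
qed

lemma marginal_eq_density:
  assumes d: "disintegrates J S T M N \<nu>" and "S \<subseteq> T"
    and M: "sets M = sets (pow J S)" and N: "sets N = sets (pow J T)"
  shows "distr N (pow J S) (\<lambda>z. restrict z S)
    = density M (\<lambda>x. emeasure (\<nu> x) (space (pow J (T - S))))" (is "?L = ?R")
proof (rule measure_eqI)
  show "sets ?L = sets ?R" using M by simp
  let ?B = "space (pow J (T - S))"
  fix A assume "A \<in> sets ?L"
  then have A: "A \<in> sets (pow J S)" by simp
  have "emeasure ?L A = emeasure N {z \<in> space (pow J T). restrict z S \<in> A \<and> restrict z (T - S) \<in> ?B}"
    using A measurable_restrict_pow[OF \<open>S \<subseteq> T\<close> N] sets_eq_imp_space_eq[OF N]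
      measurable_space[OF measurable_restrict_pow[OF Diff_subset N]]
    by (simp add: emeasure_distr) (rule arg_cong[where f="emeasure N"], auto)
  also have "\<dots> = (\<integral>\<^sup>+x\<in>A. emeasure (\<nu> x) ?B \<partial>M)"
    by (rule disintegrates_rectangle[OF d A sets.top])
  also have "\<dots> = emeasure ?R A"
    using A M by (simp add: emeasure_density disintegrates_measurable[OF d M])
  finally show "emeasure ?L A = emeasure ?R A" .
qed

text \<open>
  The total mass of the fibres is the density of the marginal.
\<close>

lemma sigma_finite_marginal_iff:
  assumes "disintegrates J S T M N \<nu>" and "S \<subseteq> T"
    and M: "sets M = sets (pow J S)" and "sets N = sets (pow J T)" and "sigma_finite_measure M"
  shows "sigma_finite_measure (distr N (pow J S) (\<lambda>z. restrict z S))
    \<longleftrightarrow> (AE x in M. emeasure (\<nu> x) (space (pow J (T - S))) \<noteq> \<infinity>)"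
proof -
  have "(\<lambda>x. emeasure (\<nu> x) (space (pow J (T - S)))) \<in> borel_measurable M"
    by (rule disintegrates_measurable[OF assms(1) M sets.top])
  then show ?thesis
    using marginal_eq_density[OF assms(1-4)]
      sigma_finite_measure.sigma_finite_iff_density_finite[OF assms(5)] by simp
qed

section \<open>Finite fibres of Markovian families\<close>

text \<open>
  The function \<open>\<nu>\<close> is the choice of disintegrations for which the Markov identities hold.
\<close>

locale markov_family_versions =
  fixes J :: "'a measure" and V :: "'v set" and E :: "'v set set"
    and \<mu> :: "'v set \<Rightarrow> ('v \<Rightarrow> 'a) measure"
    and \<nu> :: "'v set \<Rightarrow> 'v set \<Rightarrow> ('v \<Rightarrow> 'a) \<Rightarrow> ('v \<Rightarrow> 'a) measure"
  assumes finite_V: "finite V"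
    and family: "measure_family J V \<mu>"
    and disint: "\<And>S T. S \<subseteq> T \<Longrightarrow> T \<subseteq> V \<Longrightarrow> disintegrates J S T (\<mu> S) (\<mu> T) (\<nu> S T)"
    and markov: "\<And>U W. U \<subseteq> V \<Longrightarrow> W \<subseteq> V \<Longrightarrow> \<forall>u\<in>U - W. \<forall>w\<in>W - U. {u, w} \<notin> E \<Longrightarrow>
      AE x in \<mu> (U \<inter> W). \<nu> (U \<inter> W) (U \<union> W) x =
        prod_on J (U - W) (W - U) (\<nu> (U \<inter> W) U x) (\<nu> (U \<inter> W) W x)"
begin

lemma sets_\<mu>: "S \<subseteq> V \<Longrightarrow> sets (\<mu> S) = sets (pow J S)"
  and sigma_finite_\<mu>: "S \<subseteq> V \<Longrightarrow> sigma_finite_measure (\<mu> S)"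
  using family unfolding measure_family_def by auto

lemma space_\<mu>: "S \<subseteq> V \<Longrightarrow> space (\<mu> S) = space (pow J S)"
  by (rule sets_eq_imp_space_eq[OF sets_\<mu>])

definition finite_fibres :: "'v set \<Rightarrow> 'v set \<Rightarrow> bool" where
  "finite_fibres S T \<longleftrightarrow> (AE x in \<mu> S. emeasure (\<nu> S T x) (space (pow J (T - S))) \<noteq> \<infinity>)"

lemma finite_fibres_iff:
  assumes "S \<subseteq> T" and "T \<subseteq> V"
  shows "finite_fibres S T \<longleftrightarrow> sigma_finite_measure (distr (\<mu> T) (pow J S) (\<lambda>z. restrict z S))"
  unfolding finite_fibres_def
  using sigma_finite_marginal_iff[OF disint] assms sets_\<mu> sigma_finite_\<mu> by auto

lemma AE_total_mass_1:
  assumes "S \<subseteq> T" and "T \<subseteq> V" and eq: "distr (\<mu> T) (pow J S) (\<lambda>z. restrict z S) = \<mu> S"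
  shows "AE x in \<mu> S. emeasure (\<nu> S T x) (space (pow J (T - S))) = 1"
proof (rule sigma_finite_measure.density_unique)
  have S: "S \<subseteq> V" using assms by simp
  show "sigma_finite_measure (\<mu> S)" by (rule sigma_finite_\<mu>[OF S])
  show "(\<lambda>x. emeasure (\<nu> S T x) (space (pow J (T - S)))) \<in> borel_measurable (\<mu> S)"
    by (rule disintegrates_measurable[OF disint[OF assms(1,2)] sets_\<mu>[OF S] sets.top])
  show "density (\<mu> S) (\<lambda>x. emeasure (\<nu> S T x) (space (pow J (T - S)))) = density (\<mu> S) (\<lambda>_. 1)"
    using marginal_eq_density[OF disint[OF assms(1,2)] assms(1) sets_\<mu>[OF S] sets_\<mu>[OF assms(2)]]
    by (simp add: eq density_1)
qed simp

lemma marginal_self: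
  assumes "S \<subseteq> V"
  shows "distr (\<mu> S) (pow J S) (\<lambda>z. restrict z S) = \<mu> S"
proof -
  have "restrict z S = z" if "z \<in> space (\<mu> S)" for z
    using that space_\<mu>[OF assms] by (auto simp: space_PiM intro: PiE_restrict)
  then have "distr (\<mu> S) (pow J S) (\<lambda>z. restrict z S) = distr (\<mu> S) (\<mu> S) (\<lambda>z. z)"
    using sets_\<mu>[OF assms] by (intro distr_cong) auto
  then show ?thesis
    by (simp add: distr_id2[symmetric])
qed

lemma finite_fibres_refl: "S \<subseteq> V \<Longrightarrow> finite_fibres S S"
  by (simp add: finite_fibres_iff marginal_self sigma_finite_\<mu>)

text \<open>
  On product sets the product measure factorizes; this needs one factor to be sigma-finite, which is
  why the fibres of \<open>\<mu> W\<close> are assumed to be finite.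
\<close>

lemma markov_times:
  assumes "U \<subseteq> V" and "W \<subseteq> V" and "\<forall>u\<in>U - W. \<forall>w\<in>W - U. {u, w} \<notin> E"
    and "finite_fibres (U \<inter> W) W"
  shows "AE x in \<mu> (U \<inter> W). \<forall>B1\<in>sets (pow J (U - W)). \<forall>B2\<in>sets (pow J (W - U)).
    emeasure (\<nu> (U \<inter> W) (U \<union> W) x)
      {y \<in> space (pow J (U \<union> W - U \<inter> W)). restrict y (U - W) \<in> B1 \<and> restrict y (W - U) \<in> B2}
    = emeasure (\<nu> (U \<inter> W) U x) B1 * emeasure (\<nu> (U \<inter> W) W x) B2"
  using markov[OF assms(1-3)] assms(4)[unfolded finite_fibres_def] AE_space
proof eventually_elim
  fix x
  let ?a = "\<nu> (U \<inter> W) U x" and ?b = "\<nu> (U \<inter> W) W x"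
  assume prod: "\<nu> (U \<inter> W) (U \<union> W) x = prod_on J (U - W) (W - U) ?a ?b"
    and fin: "emeasure ?b (space (pow J (W - U \<inter> W))) \<noteq> \<infinity>"
    and "x \<in> space (\<mu> (U \<inter> W))"
  then have x: "x \<in> space (pow J (U \<inter> W))"
    using space_\<mu>[of "U \<inter> W"] assms(1) by auto
  have a: "sets ?a = sets (pow J (U - W))"
    using disint[of "U \<inter> W" U] assms(1) x by (simp add: disintegrates_def Diff_Int)
  have b: "sets ?b = sets (pow J (W - U))"
    using disint[of "U \<inter> W" W] assms(2) x by (simp add: disintegrates_def Diff_Int)
  interpret b: finite_measure ?b
    using fin sets_eq_imp_space_eq[OF b] by (intro finite_measureI) (simp add: Diff_Int)
  have UW: "(U - W) \<union> (W - U) = U \<union> W - U \<inter> W" by auto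
  have merge: "merge (U - W) (W - U) \<in> ?a \<Otimes>\<^sub>M ?b \<rightarrow>\<^sub>M pow J ((U - W) \<union> (W - U))"
    using measurable_merge[of "U - W" "W - U" "\<lambda>_. J"]
      measurable_cong_sets[OF sets_pair_measure_cong[OF a b] refl] by blast
  show "\<forall>B1\<in>sets (pow J (U - W)). \<forall>B2\<in>sets (pow J (W - U)).
    emeasure (\<nu> (U \<inter> W) (U \<union> W) x)
      {y \<in> space (pow J (U \<union> W - U \<inter> W)). restrict y (U - W) \<in> B1 \<and> restrict y (W - U) \<in> B2}
    = emeasure ?a B1 * emeasure ?b B2"
  proof (intro ballI)
    fix B1 B2 assume B: "B1 \<in> sets (pow J (U - W))" "B2 \<in> sets (pow J (W - U))"
    let ?R = "{y \<in> space (pow J (U \<union> W - U \<inter> W)). restrict y (U - W) \<in> B1 \<and> restrict y (W - U) \<in> B2}"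
    have R: "?R \<in> sets (pow J ((U - W) \<union> (W - U)))"
      unfolding UW using B by (intro rectangle_in_sets_pow) auto
    have "merge (U - W) (W - U) -` ?R \<inter> space (?a \<Otimes>\<^sub>M ?b) = B1 \<times> B2"
    proof -
      have sp: "space (?a \<Otimes>\<^sub>M ?b) = space (pow J (U - W)) \<times> space (pow J (W - U))"
        using sets_eq_imp_space_eq[OF a] sets_eq_imp_space_eq[OF b] by (simp add: space_pair_measure)
      have "restrict (merge (U - W) (W - U) (p, q)) (U - W) = p"
        "restrict (merge (U - W) (W - U) (p, q)) (W - U) = q"
        if "p \<in> space (pow J (U - W))" "q \<in> space (pow J (W - U))" for p q
        using that by (auto simp: fun_eq_iff space_PiM merge_def restrict_def PiE_iff extensional_def)
      moreover have "merge (U - W) (W - U) (p, q) \<in> space (pow J (U \<union> W - U \<inter> W))"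
        if "p \<in> space (pow J (U - W))" "q \<in> space (pow J (W - U))" for p q
        using measurable_space[OF merge, of "(p, q)"] that unfolding sp UW by blast
      ultimately show ?thesis
        using sets.sets_into_space[OF B(1), THEN subsetD] sets.sets_into_space[OF B(2), THEN subsetD]
        unfolding sp by auto
    qed
    then have "emeasure (\<nu> (U \<inter> W) (U \<union> W) x) ?R = emeasure (?a \<Otimes>\<^sub>M ?b) (B1 \<times> B2)"
      unfolding prod prod_on_def by (subst emeasure_distr[OF merge R]) simp
    also have "\<dots> = emeasure ?a B1 * emeasure ?b B2"
      using B a b by (intro b.emeasure_pair_measure_Times) auto
    finally show "emeasure (\<nu> (U \<inter> W) (U \<union> W) x) ?R = emeasure ?a B1 * emeasure ?b B2" .
  qed
qed

lemma markov_total_mass: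
  assumes "U \<subseteq> V" and "W \<subseteq> V" and "\<forall>u\<in>U - W. \<forall>w\<in>W - U. {u, w} \<notin> E"
    and "finite_fibres (U \<inter> W) W"
  shows "AE x in \<mu> (U \<inter> W).
    emeasure (\<nu> (U \<inter> W) (U \<union> W) x) (space (pow J (U \<union> W - U \<inter> W)))
    = emeasure (\<nu> (U \<inter> W) U x) (space (pow J (U - U \<inter> W)))
      * emeasure (\<nu> (U \<inter> W) W x) (space (pow J (W - U \<inter> W)))"
  using markov_times[OF assms]
proof eventually_elim
  fix x
  assume *: "\<forall>B1\<in>sets (pow J (U - W)). \<forall>B2\<in>sets (pow J (W - U)).
    emeasure (\<nu> (U \<inter> W) (U \<union> W) x)
      {y \<in> space (pow J (U \<union> W - U \<inter> W)). restrict y (U - W) \<in> B1 \<and> restrict y (W - U) \<in> B2}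
    = emeasure (\<nu> (U \<inter> W) U x) B1 * emeasure (\<nu> (U \<inter> W) W x) B2"
  have "{y \<in> space (pow J (U \<union> W - U \<inter> W)). restrict y (U - W) \<in> space (pow J (U - W))
      \<and> restrict y (W - U) \<in> space (pow J (W - U))} = space (pow J (U \<union> W - U \<inter> W))"
    using restrict_in_space_pow[of "U - W" "U \<union> W - U \<inter> W" _ J]
      restrict_in_space_pow[of "W - U" "U \<union> W - U \<inter> W" _ J] by blast
  moreover have "U - U \<inter> W = U - W" "W - U \<inter> W = W - U" by auto
  ultimately show "emeasure (\<nu> (U \<inter> W) (U \<union> W) x) (space (pow J (U \<union> W - U \<inter> W)))
    = emeasure (\<nu> (U \<inter> W) U x) (space (pow J (U - U \<inter> W)))
      * emeasure (\<nu> (U \<inter> W) W x) (space (pow J (W - U \<inter> W)))"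
    using *[rule_format, OF sets.top sets.top] by simp
qed

lemma finite_fibres_Un:
  assumes "U \<subseteq> V" and "W \<subseteq> V" and "\<forall>u\<in>U - W. \<forall>w\<in>W - U. {u, w} \<notin> E"
    and "finite_fibres (U \<inter> W) U" and "finite_fibres (U \<inter> W) W"
  shows "finite_fibres (U \<inter> W) (U \<union> W)"
  using markov_total_mass[OF assms(1-3,5)] assms(4,5) unfolding finite_fibres_def
  by eventually_elim (simp add: ennreal_mult_eq_top_iff)

text \<open>
  The elements of \<open>M\<close> are conditionally independent given \<open>D\<close>, so the mass of the fibres over \<open>J\<^sup>D\<close>
  is the product of the masses for the single elements.
\<close>

lemma finite_fibres_add_independent:
  assumes "D \<union> M \<subseteq> V" and "D \<inter> M = {}" and "\<forall>u\<in>M. \<forall>w\<in>M. {u, w} \<notin> E"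
    and "\<And>s. s \<in> M \<Longrightarrow> finite_fibres D (insert s D)"
  shows "finite_fibres D (D \<union> M)"
proof -
  have "finite M" using finite_subset[OF assms(1) finite_V] by simp
  then show ?thesis using assms
  proof (induction M)
    case empty
    then show ?case
      using finite_fibres_refl[of D] by simp
  next
    case (insert s M)
    have I: "(D \<union> M) \<inter> insert s D = D" and Un: "(D \<union> M) \<union> insert s D = D \<union> insert s M"
      using insert.prems insert.hyps by auto
    have "finite_fibres D (D \<union> M)"
      using insert.prems by (intro insert.IH) auto
    moreover have "finite_fibres D (insert s D)"
      using insert.prems by auto
    moreover have "\<forall>u\<in>D \<union> M - insert s D. \<forall>w\<in>insert s D - (D \<union> M). {u, w} \<notin> E"
      using insert.prems(3) by auto
    moreover have "D \<union> M \<subseteq> V" "insert s D \<subseteq> V"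
      using insert.prems(1) by auto
    ultimately show ?case
      using finite_fibres_Un[of "D \<union> M" "insert s D"] unfolding I Un by blast
  qed
qed

end

section \<open>Adding a vertex in a triangle-free graph\<close>

text \<open>
  The coordinate maps identify \<open>J\<^bsup>{i}\<^esup>\<close> with \<open>J\<close>, and \<open>J\<^bsup>{i, j}\<^esup>\<close> with \<open>J \<times> J\<close>. These two
  lemmas recover a measure from its image under this identification, in which form normalization
  prescribes it.
\<close>

lemma singleton_power_eqI:
  assumes "sets P = sets (pow J {i})" and "sets Q = sets (pow J {i})"
    and "distr P J (\<lambda>z. z i) = distr Q J (\<lambda>z. z i)"
  shows "P = Q"
proof (rule measure_eq_if_image_eq[where f = "\<lambda>z. z i" and g = "\<lambda>a. \<lambda>k\<in>{i}. a" and K = J])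
  show "(\<lambda>z. z i) \<in> P \<rightarrow>\<^sub>M J"
    unfolding measurable_cong_sets[OF assms(1) refl] by (rule measurable_component_singleton) simp
  show "(\<lambda>a. \<lambda>k\<in>{i}. a) \<in> J \<rightarrow>\<^sub>M P"
    unfolding measurable_cong_sets[OF refl assms(1)] by (rule measurable_restrict) simp
  show "(\<lambda>k\<in>{i}. z i) = z" if "z \<in> space P" for z
    using that sets_eq_imp_space_eq[OF assms(1)] by (auto simp: space_PiM PiE_iff extensional_def)
qed (use assms in auto)

lemma pair_power_eqI:
  assumes "i \<noteq> j" and "sets P = sets (pow J {i, j})" and "sets Q = sets (pow J {i, j})"
    and "distr P (J \<Otimes>\<^sub>M J) (\<lambda>z. (z i, z j)) = distr Q (J \<Otimes>\<^sub>M J) (\<lambda>z. (z i, z j))"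
  shows "P = Q"
proof (rule measure_eq_if_image_eq[where f = "\<lambda>z. (z i, z j)" and K = "J \<Otimes>\<^sub>M J"
      and g = "\<lambda>p. \<lambda>k\<in>{i, j}. if k = i then fst p else snd p"])
  show "(\<lambda>z. (z i, z j)) \<in> P \<rightarrow>\<^sub>M J \<Otimes>\<^sub>M J"
    unfolding measurable_cong_sets[OF assms(2) refl]
    by (intro measurable_Pair measurable_component_singleton) auto
  show "(\<lambda>p. \<lambda>k\<in>{i, j}. if k = i then fst p else snd p) \<in> J \<Otimes>\<^sub>M J \<rightarrow>\<^sub>M P"
    unfolding measurable_cong_sets[OF refl assms(2)] by (rule measurable_restrict) auto
  show "(\<lambda>k\<in>{i, j}. if k = i then fst (z i, z j) else snd (z i, z j)) = z"
    if "z \<in> space P" for z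
    using that sets_eq_imp_space_eq[OF assms(2)]
    by (auto simp: space_PiM PiE_iff extensional_def fun_eq_iff)
qed (use assms in auto)

locale normalized_triangle_free_family = markov_family_versions J V E \<mu> \<nu>
  for J :: "'a measure" and V :: "'v set" and E :: "'v set set" and \<mu> \<nu> +
  fixes \<eta> :: "('a \<times> 'a) measure"
  assumes prob_\<eta>: "prob_space \<eta>" and sets_\<eta>: "sets \<eta> = sets (J \<Otimes>\<^sub>M J)"
    and edges: "e \<in> E \<Longrightarrow> e \<subseteq> V \<and> card e = 2"
    and triangle_free: "triangle_free E"
    and normalized: "normalized J \<eta> V E \<mu>"
begin

lemma edge_marginal:
  assumes "{i, j} \<in> E"
  shows "distr (\<mu> {i, j}) (pow J {i}) (\<lambda>z. restrict z {i}) = \<mu> {i}"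
proof (rule singleton_power_eqI)
  have V: "{i, j} \<subseteq> V" using edges[OF assms] by simp
  have proj: "(\<lambda>z. z k) \<in> \<mu> {i, j} \<rightarrow>\<^sub>M J" if "k \<in> {i, j}" for k
    unfolding measurable_cong_sets[OF sets_\<mu>[OF V] refl]
    using that by (intro measurable_component_singleton)
  show "sets (\<mu> {i}) = sets (pow J {i})" using V sets_\<mu>[of "{i}"] by simp
  have "distr (distr (\<mu> {i, j}) (pow J {i}) (\<lambda>z. restrict z {i})) J (\<lambda>z. z i)
      = distr (\<mu> {i, j}) J (\<lambda>z. z i)"
    using measurable_restrict_pow[OF _ sets_\<mu>[OF V], of "{i}"]
      measurable_component_singleton[of i "{i}" "\<lambda>_. J"]
    by (subst distr_distr) (auto simp: comp_def)
  also have "\<dots> = distr (distr (\<mu> {i, j}) (J \<Otimes>\<^sub>M J) (\<lambda>z. (z i, z j))) J fst"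
    using proj by (subst distr_distr) (auto simp: comp_def)
  also have "\<dots> = distr (\<mu> {i}) J (\<lambda>z. z i)"
    using normalized assms V unfolding normalized_def marginal_def by simp
  finally show "distr (distr (\<mu> {i, j}) (pow J {i}) (\<lambda>z. restrict z {i})) J (\<lambda>z. z i)
      = distr (\<mu> {i}) J (\<lambda>z. z i)" .
qed simp

lemma mass_vertex:
  assumes "i \<in> V"
  shows "emeasure (\<mu> {i}) (space (\<mu> {i})) = 1"
proof -
  have V: "{i} \<subseteq> V" using assms by simp
  have "fst \<in> \<eta> \<rightarrow>\<^sub>M J"
    unfolding measurable_cong_sets[OF sets_\<eta> refl] by simp
  then have "prob_space (distr (\<mu> {i}) J (\<lambda>z. z i))"
    using normalized assms prob_space.prob_space_distr[OF prob_\<eta>]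
    unfolding normalized_def marginal_def by simp
  moreover have "(\<lambda>z. z i) \<in> \<mu> {i} \<rightarrow>\<^sub>M J"
    unfolding measurable_cong_sets[OF sets_\<mu>[OF V] refl] by (rule measurable_component_singleton) simp
  ultimately show ?thesis
    using prob_space_distrD prob_space.emeasure_space_1 by blast
qed

text \<open>
  The leaves of a star are independent because the graph has no triangle, so the fibre over the
  centre is a product of fibres of edge measures. Each of these has mass 1, because the edge
  measure and the vertex measure have the same marginal.
\<close>

lemma star_fibre_mass:
  assumes "N \<subseteq> V" and "i \<in> V" and "\<And>j. j \<in> N \<Longrightarrow> {i, j} \<in> E"
  shows "AE x in \<mu> {i}. emeasure (\<nu> {i} (insert i N) x) (space (pow J (insert i N - {i}))) = 1"
proof -
  have "finite N" using assms(1) finite_V finite_subset by blast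
  then show ?thesis using assms
  proof (induction N)
    case empty
    then show ?case
      by (intro AE_total_mass_1 marginal_self) auto
  next
    case (insert j N)
    have ij: "{i, j} \<in> E" using insert.prems by simp
    then have "card {i, j} = 2" using edges by blast
    then have "i \<noteq> j" by auto
    have I: "insert i N \<inter> {i, j} = {i}" and Un: "insert i N \<union> {i, j} = insert i (insert j N)"
      using insert.hyps \<open>i \<noteq> j\<close> by auto
    have edge: "AE x in \<mu> {i}. emeasure (\<nu> {i} {i, j} x) (space (pow J ({i, j} - {i}))) = 1"
      using edges[OF ij] by (intro AE_total_mass_1 edge_marginal ij) auto
    then have fin: "finite_fibres {i} {i, j}"
      unfolding finite_fibres_def by eventually_elim simp
    have non_edge: "\<forall>u\<in>insert i N - {i, j}. \<forall>w\<in>{i, j} - insert i N. {u, w} \<notin> E"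
    proof (intro ballI notI)
      fix u w assume "u \<in> insert i N - {i, j}" "w \<in> {i, j} - insert i N" "{u, w} \<in> E"
      then have "{u, i} \<in> E" "{i, j} \<in> E" "{u, j} \<in> E"
        using insert.prems(3)[of u] ij by (auto simp: insert_commute)
      then show False using triangle_free unfolding triangle_free_def by blast
    qed
    have "AE x in \<mu> {i}. emeasure (\<nu> {i} (insert i N) x) (space (pow J (insert i N - {i}))) = 1"
      using insert.prems by (intro insert.IH) auto
    moreover have "AE x in \<mu> {i}. emeasure (\<nu> {i} (insert i (insert j N)) x)
        (space (pow J (insert i (insert j N) - {i})))
      = emeasure (\<nu> {i} (insert i N) x) (space (pow J (insert i N - {i})))
        * emeasure (\<nu> {i} {i, j} x) (space (pow J ({i, j} - {i})))"
      using markov_total_mass[of "insert i N" "{i, j}"] insert.prems non_edge fin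
      unfolding I Un by auto
    ultimately show ?case using edge by eventually_elim simp
  qed
qed

text \<open>
  A star carries a probability measure, and every marginal of a finite measure is finite.
\<close>

lemma finite_fibres_star:
  assumes "N \<subseteq> V" and "i \<in> V" and "\<And>j. j \<in> N \<Longrightarrow> {i, j} \<in> E" and "S \<subseteq> insert i N"
  shows "finite_fibres S (insert i N)"
proof -
  let ?T = "insert i N"
  have T: "?T \<subseteq> V" using assms by auto
  have i: "{i} \<subseteq> V" "{i} \<subseteq> ?T" using assms by auto
  have "emeasure (\<mu> ?T) (space (\<mu> ?T))
      = emeasure (distr (\<mu> ?T) (pow J {i}) (\<lambda>z. restrict z {i})) (space (pow J {i}))"
    using measurable_restrict_pow[OF i(2) sets_\<mu>[OF T]] measurable_space[OF measurable_restrict_pow[OF i(2) sets_\<mu>[OF T]]]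
    by (subst emeasure_distr) (auto intro!: arg_cong[where f = "emeasure (\<mu> ?T)"])
  also have "\<dots> = (\<integral>\<^sup>+x. emeasure (\<nu> {i} ?T x) (space (pow J (?T - {i}))) * indicator (space (\<mu> {i})) x \<partial>\<mu> {i})"
    unfolding marginal_eq_density[OF disint[OF i(2) T] i(2) sets_\<mu>[OF i(1)] sets_\<mu>[OF T]]
      space_\<mu>[OF i(1), symmetric]
    by (rule emeasure_density[OF disintegrates_measurable[OF disint[OF i(2) T] sets_\<mu>[OF i(1)] sets.top] sets.top])
  also have "\<dots> = (\<integral>\<^sup>+x. indicator (space (\<mu> {i})) x \<partial>\<mu> {i})"
    using star_fibre_mass[OF assms(1-3)] by (intro nn_integral_cong_AE) auto
  also have "\<dots> = 1"
    using mass_vertex[OF assms(2)] by simp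
  finally have "finite_measure (\<mu> ?T)" by (intro finite_measureI) simp
  then have "finite_measure (distr (\<mu> ?T) (pow J S) (\<lambda>z. restrict z S))"
    by (rule finite_measure.finite_measure_distr[OF _ measurable_restrict_pow[OF assms(4) sets_\<mu>[OF T]]])
  then show ?thesis
    using finite_fibres_iff[OF assms(4) T] finite_measure.axioms(1) by blast
qed

text \<open>
  In terms of densities: the mass of the fibre over \<open>x \<in> J\<^sup>C\<close> is the mass of the star fibre over
  \<open>x\<^bsub>N\<^esub>\<close>, where \<open>N\<close> is the set of neighbours of \<open>i\<close> in \<open>C\<close>.
\<close>

theorem finite_fibres_insert:
  assumes "C \<subseteq> V" and "i \<in> V" and "i \<notin> C"
  shows "finite_fibres C (insert i C)"
  using assms
proof (induction "card C" arbitrary: C i rule: less_induct)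
  case less
  define N where "N = {j \<in> C. {i, j} \<in> E}"
  define D where "D = C - N"
  have fin: "finite C" using less.prems finite_V finite_subset by blast
  have C: "C = N \<union> D" and ND: "N \<inter> D = {}" "N \<subseteq> C" "D \<subseteq> C"
    unfolding N_def D_def by auto
  have V: "N \<subseteq> V" "D \<subseteq> V" "insert i N \<subseteq> V" "insert i C \<subseteq> V"
    using less.prems ND by auto
  have adj: "{i, j} \<in> E" if "j \<in> N" for j using that by (simp add: N_def)
  have indep: "\<forall>u\<in>N. \<forall>w\<in>N. {u, w} \<notin> E"
  proof (intro ballI notI)
    fix u w assume "u \<in> N" "w \<in> N" "{u, w} \<in> E"
    then have "{i, u} \<in> E" "{u, w} \<in> E" "{i, w} \<in> E" using adj by auto
    then show False using triangle_free unfolding triangle_free_def by blast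
  qed
  have star: "finite_fibres N (insert i N)"
    using V less.prems adj by (intro finite_fibres_star) auto
  have "finite_fibres D (D \<union> N)"
  proof (rule finite_fibres_add_independent)
    fix s assume s: "s \<in> N"
    have "card D < card C"
      unfolding D_def using s ND(2) fin by (intro psubset_card_mono) auto
    then show "finite_fibres D (insert s D)"
      using s V ND by (intro less.hyps) auto
  qed (use V ND indep in auto)
  then have "finite_fibres D C" by (simp add: C Un_commute)
  then have "sigma_finite_measure (distr (\<mu> C) (pow J D) (\<lambda>z. restrict z D))"
    using finite_fibres_iff less.prems ND by blast
  then obtain B :: "nat \<Rightarrow> ('v \<Rightarrow> 'a) set" where
    B: "range B \<subseteq> sets (pow J D)" "(\<Union>n. B n) = space (pow J D)" "incseq B"
      and B_fin: "\<And>n. emeasure (distr (\<mu> C) (pow J D) (\<lambda>z. restrict z D)) (B n) \<noteq> \<infinity>"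
    using sigma_finite_measure.sigma_finite_incseq by (metis sets_distr space_distr)
  define f where "f = (\<lambda>x. emeasure (\<nu> N (insert i N) x) (space (pow J {i})))"
  \<comment> \<open>Changed on a null set to be finite everywhere, so that the sets \<open>A n\<close> below cover \<open>J\<^sup>N\<close>.\<close>
  define f' where "f' = (\<lambda>x. if f x = \<infinity> then 0 else f x)"
  have iN: "insert i N - N = {i}" using less.prems ND by auto
  have iC: "insert i C - C = {i}" using less.prems by auto
  have f: "f \<in> borel_measurable (pow J N)"
    using disintegrates_measurable[OF disint[OF subset_insertI V(3)] sets_\<mu>[OF V(1)] sets.top]
    unfolding f_def iN measurable_cong_sets[OF sets_\<mu>[OF V(1)] refl] .
  then have f': "f' \<in> borel_measurable (pow J N)" unfolding f'_def by measurable
  have f_eq: "AE x in \<mu> N. f x = f' x"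
    using star unfolding finite_fibres_def iN f_def f'_def by eventually_elim simp
  let ?M = "distr (\<mu> (insert i C)) (pow J C) (\<lambda>z. restrict z C)"
  let ?D = "density (\<mu> C) (\<lambda>z. f' (restrict z N))"
  have rN: "(\<lambda>z. restrict z N) \<in> \<mu> C \<rightarrow>\<^sub>M pow J N"
    using measurable_restrict_pow[OF ND(2) sets_\<mu>] less.prems by blast
  have rD: "(\<lambda>z. restrict z D) \<in> \<mu> C \<rightarrow>\<^sub>M pow J D"
    using measurable_restrict_pow[OF ND(3) sets_\<mu>] less.prems by blast
  have f'r: "(\<lambda>z. f' (restrict z N)) \<in> borel_measurable (\<mu> C)"
    by (rule measurable_compose[OF rN f'])
  have CN: "C - N = D" unfolding D_def ..
  have rect: "emeasure ?M {z \<in> space (pow J C). restrict z N \<in> A \<and> restrict z D \<in> Y}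
      = emeasure ?D {z \<in> space (pow J C). restrict z N \<in> A \<and> restrict z D \<in> Y}"
    if A: "A \<in> sets (pow J N)" and Y: "Y \<in> sets (pow J D)" for A Y
  proof -
    let ?R = "{z \<in> space (pow J C). restrict z N \<in> A \<and> restrict z D \<in> Y}"
    let ?Y = "{y \<in> space (pow J (insert i D)). restrict y D \<in> Y \<and> restrict y {i} \<in> space (pow J {i})}"
    have R: "?R \<in> sets (pow J C)"
      by (rule rectangle_in_sets_pow[OF ND(2,3) A Y])
    have Y': "?Y \<in> sets (pow J (insert i D))"
      using Y by (intro rectangle_in_sets_pow) auto
    have TN: "insert i C - N = insert i D" using less.prems ND CN by auto
    have "emeasure ?M ?R = emeasure (\<mu> (insert i C)) ((\<lambda>z. restrict z C) -` ?R \<inter> space (\<mu> (insert i C)))"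
      using measurable_restrict_pow[OF subset_insertI sets_\<mu>[OF V(4)]] R by (rule emeasure_distr)
    also have "(\<lambda>z. restrict z C) -` ?R \<inter> space (\<mu> (insert i C)) =
        {z \<in> space (pow J (insert i C)). restrict z N \<in> A \<and> restrict z (insert i C - N) \<in> ?Y}"
    proof -
      have "restrict z C \<in> space (pow J C)" "restrict z (insert i D) \<in> space (pow J (insert i D))"
        "restrict z {i} \<in> space (pow J {i})"
        if "z \<in> space (pow J (insert i C))" for z
        using that ND by (auto intro!: restrict_in_space_pow[of _ "insert i C"])
      moreover have "restrict (restrict z C) N = restrict z N" "restrict (restrict z C) D = restrict z D"
        "restrict (restrict z (insert i D)) D = restrict z D"
        "restrict (restrict z (insert i D)) {i} = restrict z {i}" for z :: "'v \<Rightarrow> 'a"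
        using ND by (auto simp: Int_absorb1 Int_absorb2)
      ultimately show ?thesis
        unfolding TN space_\<mu>[OF V(4)] by auto
    qed
    also have "emeasure (\<mu> (insert i C)) \<dots> = (\<integral>\<^sup>+x\<in>A. emeasure (\<nu> N (insert i C) x) ?Y \<partial>\<mu> N)"
      using ND Y' by (intro disintegrates_rectangle[OF disint[OF _ V(4)] A]) (auto simp: TN)
    also have "\<dots> = (\<integral>\<^sup>+x. (f' x * indicator A x) * emeasure (\<nu> N C x) Y \<partial>\<mu> N)"
    proof (rule nn_integral_cong_AE)
      have I: "C \<inter> insert i N = N" "C \<union> insert i N = insert i C" "C - insert i N = D"
        "insert i N - C = {i}" "insert i C - N = insert i D"
        using less.prems ND CN by auto
      have "\<forall>u\<in>C - insert i N. \<forall>w\<in>insert i N - C. {u, w} \<notin> E"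
        unfolding I unfolding D_def N_def by (auto simp: insert_commute)
      then have "AE x in \<mu> N. \<forall>B1\<in>sets (pow J D). \<forall>B2\<in>sets (pow J {i}).
        emeasure (\<nu> N (insert i C) x) {y \<in> space (pow J (insert i D)). restrict y D \<in> B1 \<and> restrict y {i} \<in> B2}
        = emeasure (\<nu> N C x) B1 * emeasure (\<nu> N (insert i N) x) B2"
        using markov_times[of C "insert i N"] less.prems V star unfolding I by blast
      then show "AE x in \<mu> N. emeasure (\<nu> N (insert i C) x) ?Y * indicator A x
          = (f' x * indicator A x) * emeasure (\<nu> N C x) Y"
        using f_eq
      proof eventually_elim
        case (elim x)
        then have "emeasure (\<nu> N (insert i C) x) ?Y = emeasure (\<nu> N C x) Y * f x"
          unfolding f_def using Y sets.top[of "pow J {i}"] by blast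
        then show ?case using elim(2) by (simp add: ac_simps)
      qed
    qed
    also have "\<dots> = (\<integral>\<^sup>+z. (f' (restrict z N) * indicator A (restrict z N)) * indicator Y (restrict z D) \<partial>\<mu> C)"
      using disintegrates_nn_integral[OF disint[OF ND(2) less.prems(1)] ND(2) sets_\<mu>[OF V(1)]
          sets_\<mu>[OF less.prems(1)], of Y "\<lambda>x. f' x * indicator A x"] A Y f'
      unfolding CN by simp
    also have "\<dots> = (\<integral>\<^sup>+z\<in>?R. f' (restrict z N) \<partial>\<mu> C)"
      using space_\<mu>[OF less.prems(1)] by (intro nn_integral_cong) (auto split: split_indicator)
    also have "\<dots> = emeasure ?D ?R"
      using R sets_\<mu>[OF less.prems(1)] by (intro emeasure_density[symmetric] f'r) simp
    finally show ?thesis .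
  qed
  \<comment> \<open>Both sequences increase, so the diagonal rectangles \<open>A n \<times> B n\<close> already cover \<open>J\<^sup>C\<close>. Each has
    finite measure, because the density is at most \<open>n\<close> on it.\<close>
  define A where "A n = {x \<in> space (pow J N). f' x \<le> of_nat n}" for n :: nat
  have A: "A n \<in> sets (pow J N)" for n
    unfolding A_def using f' by measurable
  define R where "R n = {z \<in> space (pow J C). restrict z N \<in> A n \<and> restrict z D \<in> B n}" for n
  have "?D = ?M"
  proof (rule measure_eq_if_eq_on_boxes[where R = R])
    show "finite C" by fact
    show "sets ?D = sets (pow J C)" using sets_\<mu> less.prems by simp
    show "sets ?M = sets (pow J C)" by simp
    show "R n \<in> sets (pow J C)" for n
      unfolding R_def using A B(1) by (intro rectangle_in_sets_pow ND) auto
    show "(\<Union>n. R n) = space (pow J C)"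
    proof (intro equalityI subsetI)
      fix z assume z: "z \<in> space (pow J C)"
      then have zN: "restrict z N \<in> space (pow J N)" and "restrict z D \<in> space (pow J D)"
        using restrict_in_space_pow ND by blast+
      then obtain k where k: "restrict z D \<in> B k" using B(2) by blast
      have "f' (restrict z N) < \<infinity>" unfolding f'_def by (simp add: less_top)
      then obtain l :: nat where l: "f' (restrict z N) \<le> of_nat l"
        using ennreal_Ex_less_of_nat[of "f' (restrict z N)"] by (auto intro: less_imp_le)
      have "f' (restrict z N) \<le> of_nat (max k l)"
        using l by (rule order_trans) simp
      moreover have "restrict z D \<in> B (max k l)"
        using k B(3) by (meson incseqD max.cobounded1 subsetD)
      ultimately have "z \<in> R (max k l)" using z zN unfolding R_def A_def by simp
      then show "z \<in> (\<Union>n. R n)" by blast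
    qed (auto simp: R_def)
    show "emeasure ?D (R n) \<noteq> \<infinity>" for n
    proof -
      have Rn: "R n \<in> sets (\<mu> C)"
        unfolding R_def sets_\<mu>[OF less.prems(1)] using A B(1) by (intro rectangle_in_sets_pow ND) auto
      have pre: "(\<lambda>z. restrict z D) -` B n \<inter> space (\<mu> C) \<in> sets (\<mu> C)"
        using B(1) by (intro measurable_sets[OF rD]) auto
      have "emeasure ?D (R n) = (\<integral>\<^sup>+z\<in>R n. f' (restrict z N) \<partial>\<mu> C)"
        by (rule emeasure_density[OF f'r Rn])
      also have "\<dots> \<le> (\<integral>\<^sup>+z. of_nat n * indicator ((\<lambda>z. restrict z D) -` B n \<inter> space (\<mu> C)) z \<partial>\<mu> C)"
        by (intro nn_integral_mono) (auto simp: R_def A_def split: split_indicator)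
      also have "\<dots> = of_nat n * emeasure (distr (\<mu> C) (pow J D) (\<lambda>z. restrict z D)) (B n)"
        using pre B(1) by (subst emeasure_distr[OF rD]) (auto simp: nn_integral_cmult_indicator)
      also have "\<dots> < \<infinity>"
        using B_fin[of n] by (simp add: ennreal_mult_less_top less_top of_nat_less_top)
      finally show ?thesis by simp
    qed
    show "emeasure ?D (R n \<inter> Pi\<^sub>E C F) = emeasure ?M (R n \<inter> Pi\<^sub>E C F)"
      if F: "\<And>k. k \<in> C \<Longrightarrow> F k \<in> sets J" for n F
    proof -
      have "R n \<inter> Pi\<^sub>E C F = {z \<in> space (pow J C). restrict z N \<in> A n \<inter> Pi\<^sub>E N F
          \<and> restrict z D \<in> B n \<inter> Pi\<^sub>E D F}"
        unfolding R_def using F C by (intro box_Int_rectangle sets.sets_into_space) auto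
      moreover have "A n \<inter> Pi\<^sub>E N F \<in> sets (pow J N)"
        using F ND(2) finite_subset[OF ND(2) fin] by (intro sets.Int[OF A] sets_PiM_I_finite) auto
      moreover have "B n \<inter> Pi\<^sub>E D F \<in> sets (pow J D)"
        using B(1) F ND(3) finite_subset[OF ND(3) fin]
        by (intro sets.Int sets_PiM_I_finite) auto
      ultimately show ?thesis by (simp only: rect)
    qed
  qed
  moreover have "sigma_finite_measure ?D"
    using sigma_finite_measure.sigma_finite_iff_density_finite[OF sigma_finite_\<mu>[OF less.prems(1)] f'r]
    by (auto simp: f'_def)
  ultimately show ?case
    using finite_fibres_iff[OF subset_insertI V(4)] by simp
qed

end

section \<open>Uniqueness\<close>

text \<open>
  For fixed boxes in the coordinates \<open>i\<close> and \<open>j\<close>, the fibres of both families agree almost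
  everywhere, because they factorize into fibres of smaller measures. Finite fibres over \<open>J\<^sup>C\<close>
  provide the cover that makes these values determine the whole measure.
\<close>

lemma markov_step_unique:
  fixes \<mu> \<mu>' :: "'v set \<Rightarrow> ('v \<Rightarrow> 'a) measure"
  assumes 1: "normalized_triangle_free_family J V E \<mu> \<nu> \<eta>"
    and 2: "normalized_triangle_free_family J V E \<mu>' \<nu>' \<eta>"
    and T: "T \<subseteq> V" and ij: "i \<in> T" "j \<in> T" "i \<noteq> j" "{i, j} \<notin> E"
    and eq: "\<And>S. S \<subset> T \<Longrightarrow> \<mu> S = \<mu>' S"
  shows "\<mu> T = \<mu>' T"
proof -
  interpret F: normalized_triangle_free_family J V E \<mu> \<nu> \<eta> by fact
  interpret G: normalized_triangle_free_family J V E \<mu>' \<nu>' \<eta> by fact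
  define C where "C = T - {i, j}"
  let ?U = "insert i C" and ?W = "insert j C"
  have C: "C \<subset> T" "?U \<subset> T" "?W \<subset> T" and CV: "C \<subseteq> V" "?U \<subseteq> V" "?W \<subseteq> V"
    and notin: "i \<notin> C" "j \<notin> C"
    using ij T unfolding C_def by auto
  have iV: "i \<in> V" "j \<in> V" using ij T by auto
  have I: "?U \<inter> ?W = C" "?U \<union> ?W = T" "?U - ?W = {i}" "?W - ?U = {j}"
    "T - C = {i, j}" "?U - C = {i}" "?W - C = {j}"
    using ij unfolding C_def by auto
  have non_edge: "\<forall>u\<in>?U - ?W. \<forall>w\<in>?W - ?U. {u, w} \<notin> E"
    unfolding I using ij by simp
  have "F.finite_fibres C T"
    using F.finite_fibres_Un[OF CV(2,3) non_edge] F.finite_fibres_insert[OF CV(1)] iV notin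
    unfolding I by blast
  then have "sigma_finite_measure (distr (\<mu> T) (pow J C) (\<lambda>z. restrict z C))"
    using F.finite_fibres_iff C(1) T by blast
  then obtain A :: "nat \<Rightarrow> ('v \<Rightarrow> 'a) set" where
    A: "range A \<subseteq> sets (pow J C)" "(\<Union>n. A n) = space (pow J C)"
      and A_fin: "\<And>n. emeasure (distr (\<mu> T) (pow J C) (\<lambda>z. restrict z C)) (A n) \<noteq> \<infinity>"
    using sigma_finite_measure.sigma_finite_incseq by (metis sets_distr space_distr)
  have CT: "C \<subseteq> T" using C by auto
  have r: "(\<lambda>z. restrict z C) \<in> \<mu> T \<rightarrow>\<^sub>M pow J C"
    by (rule measurable_restrict_pow[OF CT F.sets_\<mu>[OF T]])
  define R where "R n = (\<lambda>z. restrict z C) -` A n \<inter> space (pow J T)" for n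
  have product: "AE x in \<mu> C. emeasure (\<nu> C T x)
        {y \<in> space (pow J {i, j}). restrict y {i} \<in> B1 \<and> restrict y {j} \<in> B2}
      = emeasure (\<nu>' C T x)
        {y \<in> space (pow J {i, j}). restrict y {i} \<in> B1 \<and> restrict y {j} \<in> B2}"
    if B: "B1 \<in> sets (pow J {i})" "B2 \<in> sets (pow J {j})" for B1 B2
  proof -
    have "AE x in \<mu> C. emeasure (\<nu> C ?U x) B1 = emeasure (\<nu>' C ?U x) B1"
      using F.disint[OF subset_insertI CV(2)] G.disint[OF subset_insertI CV(2)] B
      by (intro disintegrates_unique[OF F.sigma_finite_\<mu>[OF CV(1)] F.sets_\<mu>[OF CV(1)]])
        (auto simp: I eq C)
    moreover have "AE x in \<mu> C. emeasure (\<nu> C ?W x) B2 = emeasure (\<nu>' C ?W x) B2"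
      using F.disint[OF subset_insertI CV(3)] G.disint[OF subset_insertI CV(3)] B
      by (intro disintegrates_unique[OF F.sigma_finite_\<mu>[OF CV(1)] F.sets_\<mu>[OF CV(1)]])
        (auto simp: I eq C)
    moreover note F.markov_times[OF CV(2,3) non_edge, unfolded I,
        OF F.finite_fibres_insert[OF CV(1) iV(2) notin(2)]]
    moreover note G.markov_times[OF CV(2,3) non_edge, unfolded I,
        OF G.finite_fibres_insert[OF CV(1) iV(2) notin(2)], folded eq[OF C(1)]]
    ultimately show ?thesis
      by eventually_elim (use B in simp)
  qed
  show ?thesis
  proof (rule measure_eq_if_eq_on_boxes[where R = R])
    show fT: "finite T" using T F.finite_V finite_subset by blast
    show "sets (\<mu> T) = sets (pow J T)" "sets (\<mu>' T) = sets (pow J T)"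
      using F.sets_\<mu> G.sets_\<mu> T by auto
    show "R n \<in> sets (pow J T)" for n
      unfolding R_def using A(1) by (intro measurable_sets[OF measurable_restrict_subset[OF CT]]) auto
    show "(\<Union>n. R n) = space (pow J T)"
    proof (intro equalityI subsetI)
      fix z assume z: "z \<in> space (pow J T)"
      then have "restrict z C \<in> (\<Union>n. A n)"
        using restrict_in_space_pow[OF CT] A(2) by blast
      then show "z \<in> (\<Union>n. R n)" using z unfolding R_def by blast
    qed (auto simp: R_def)
    show "emeasure (\<mu> T) (R n) \<noteq> \<infinity>" for n
    proof -
      have "A n \<in> sets (pow J C)" using A(1) by auto
      then show ?thesis
        using A_fin[of n] emeasure_distr[OF r] unfolding R_def F.space_\<mu>[OF T, symmetric] by simp
    qed
    show "emeasure (\<mu> T) (R n \<inter> Pi\<^sub>E T F) = emeasure (\<mu>' T) (R n \<inter> Pi\<^sub>E T F)"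
      if F: "\<And>k. k \<in> T \<Longrightarrow> F k \<in> sets J" for n F
    proof -
      let ?Y = "{y \<in> space (pow J {i, j}). restrict y {i} \<in> Pi\<^sub>E {i} F \<and> restrict y {j} \<in> Pi\<^sub>E {j} F}"
      have A': "A n \<inter> Pi\<^sub>E C F \<in> sets (pow J C)"
        using A(1) F CT finite_subset[OF CT fT] by (intro sets.Int sets_PiM_I_finite) auto
      have B: "Pi\<^sub>E {i} F \<in> sets (pow J {i})" "Pi\<^sub>E {j} F \<in> sets (pow J {j})"
        using F ij by (auto intro!: sets_PiM_I_finite)
      then have Y: "?Y \<in> sets (pow J (T - C))"
        unfolding I by (intro rectangle_in_sets_pow) auto
      have Y_eq: "?Y = Pi\<^sub>E {i, j} F"
        using F[of i, THEN sets.sets_into_space] F[of j, THEN sets.sets_into_space] ij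
        by (auto simp: space_PiM PiE_iff extensional_def)
      have "R n \<inter> Pi\<^sub>E T F = {z \<in> space (pow J T). restrict z C \<in> A n
          \<and> restrict z (T - C) \<in> space (pow J (T - C))} \<inter> Pi\<^sub>E T F"
        unfolding R_def using restrict_in_space_pow[of "T - C" T _ J] by auto
      also have "\<dots> = {z \<in> space (pow J T). restrict z C \<in> A n \<inter> Pi\<^sub>E C F
          \<and> restrict z (T - C) \<in> space (pow J (T - C)) \<inter> Pi\<^sub>E (T - C) F}"
        using F CT by (intro box_Int_rectangle sets.sets_into_space) auto
      also have "space (pow J (T - C)) \<inter> Pi\<^sub>E (T - C) F = ?Y"
        using sets.sets_into_space[OF Y] unfolding Y_eq I by auto
      finally have box: "R n \<inter> Pi\<^sub>E T F
          = {z \<in> space (pow J T). restrict z C \<in> A n \<inter> Pi\<^sub>E C F \<and> restrict z (T - C) \<in> ?Y}" .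
      have "(\<integral>\<^sup>+x\<in>A n \<inter> Pi\<^sub>E C F. emeasure (\<nu> C T x) ?Y \<partial>\<mu> C)
          = (\<integral>\<^sup>+x\<in>A n \<inter> Pi\<^sub>E C F. emeasure (\<nu>' C T x) ?Y \<partial>\<mu>' C)"
        unfolding eq[OF C(1), symmetric]
        by (rule nn_integral_cong_AE, use product[OF B] in eventually_elim) simp
      then show ?thesis
        unfolding box disintegrates_rectangle[OF F.disint[OF CT T] A' Y]
          disintegrates_rectangle[OF G.disint[OF CT T] A' Y] .
    qed
  qed
qed

lemma clique_unique:
  assumes 1: "normalized_triangle_free_family J V E \<mu> \<nu> \<eta>"
    and 2: "normalized_triangle_free_family J V E \<mu>' \<nu>' \<eta>"
    and T: "T \<subseteq> V" and clique: "\<And>i j. i \<in> T \<Longrightarrow> j \<in> T \<Longrightarrow> i \<noteq> j \<Longrightarrow> {i, j} \<in> E"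
  shows "\<mu> T = \<mu>' T"
proof -
  interpret F: normalized_triangle_free_family J V E \<mu> \<nu> \<eta> by fact
  interpret G: normalized_triangle_free_family J V E \<mu>' \<nu>' \<eta> by fact
  note n = F.normalized G.normalized
  consider "T = {}" | i where "T = {i}" | i j where "T = {i, j}" "i \<noteq> j"
    | i j k where "i \<in> T" "j \<in> T" "k \<in> T" "i \<noteq> j" "j \<noteq> k" "i \<noteq> k"
    by blast
  then show ?thesis
  proof cases
    case 1
    then show ?thesis using n unfolding normalized_def by simp
  next
    case 2
    have "distr (\<mu> {i}) J (\<lambda>z. z i) = distr (\<mu>' {i}) J (\<lambda>z. z i)"
      using n T 2 unfolding normalized_def by simp
    then show ?thesis
      using singleton_power_eqI[OF F.sets_\<mu>[OF T, unfolded 2] G.sets_\<mu>[OF T, unfolded 2]]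
      unfolding 2 by blast
  next
    case 3
    then have "{i, j} \<in> E" using clique by simp
    then have "distr (\<mu> {i, j}) (J \<Otimes>\<^sub>M J) (\<lambda>z. (z i, z j))
        = distr (\<mu>' {i, j}) (J \<Otimes>\<^sub>M J) (\<lambda>z. (z i, z j))"
      using n unfolding normalized_def by simp
    then show ?thesis
      using pair_power_eqI[OF 3(2) F.sets_\<mu>[OF T, unfolded 3(1)] G.sets_\<mu>[OF T, unfolded 3(1)]]
      unfolding 3(1) by blast
  next
    case 4
    then have "{i, j} \<in> E" "{j, k} \<in> E" "{i, k} \<in> E" using clique by auto
    then show ?thesis using F.triangle_free unfolding triangle_free_def by blast
  qed
qed

lemma markovian_versions:
  assumes "markov_space J \<eta>" and "simple_graph V E" and "triangle_free E"
    and "measure_family J V \<mu>" and "normalized J \<eta> V E \<mu>" and "markovian J V E \<mu>"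
  obtains \<nu> where "normalized_triangle_free_family J V E \<mu> \<nu> \<eta>"
proof -
  from assms(6) obtain \<nu> where
    d: "\<forall>S T. S \<subseteq> T \<longrightarrow> T \<subseteq> V \<longrightarrow> disintegrates J S T (\<mu> S) (\<mu> T) (\<nu> S T)"
    and m: "\<forall>U W S. U \<subseteq> V \<longrightarrow> W \<subseteq> V \<longrightarrow> S = U \<inter> W \<longrightarrow>
        (\<forall>u\<in>U - S. \<forall>w\<in>W - S. {u, w} \<notin> E) \<longrightarrow>
        (AE x in \<mu> S. \<nu> S (U \<union> W) x = prod_on J (U - S) (W - S) (\<nu> S U x) (\<nu> S W x))"
    unfolding markovian_def by (elim conjE exE)
  have "normalized_triangle_free_family J V E \<mu> \<nu> \<eta>"
  proof (intro normalized_triangle_free_family.intro markov_family_versions.intro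
      normalized_triangle_free_family_axioms.intro)
    show "finite V" "measure_family J V \<mu>" "triangle_free E" "normalized J \<eta> V E \<mu>"
      "prob_space \<eta>" "sets \<eta> = sets (J \<Otimes>\<^sub>M J)"
      using assms unfolding markov_space_def simple_graph_def by simp_all
    show "e \<subseteq> V \<and> card e = 2" if "e \<in> E" for e
      using assms(2) that unfolding simple_graph_def by blast
    show "disintegrates J S T (\<mu> S) (\<mu> T) (\<nu> S T)" if "S \<subseteq> T" "T \<subseteq> V" for S T
      using d that by simp
    show "AE x in \<mu> (U \<inter> W). \<nu> (U \<inter> W) (U \<union> W) x =
        prod_on J (U - W) (W - U) (\<nu> (U \<inter> W) U x) (\<nu> (U \<inter> W) W x)"
      if "U \<subseteq> V" "W \<subseteq> V" "\<forall>u\<in>U - W. \<forall>w\<in>W - U. {u, w} \<notin> E" for U W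
    proof -
      have "U - U \<inter> W = U - W" "W - U \<inter> W = W - U" by auto
      then show ?thesis
        using m[rule_format, OF that(1,2) refl] that(3) by simp
    qed
  qed
  then show thesis by (rule that)
qed

theorem theorem1p1:
  fixes J :: "'a measure" and \<eta> :: "('a \<times> 'a) measure"
    and V :: "'v set" and E :: "'v set set"
    and \<mu> \<mu>' :: "'v set \<Rightarrow> ('v \<Rightarrow> 'a) measure"
  assumes "markov_space J \<eta>"
    and "simple_graph V E" and "triangle_free E"
    and "measure_family J V \<mu>" and "normalized J \<eta> V E \<mu>"
    and "decreasing J V \<mu>" and "markovian J V E \<mu>"
    and "measure_family J V \<mu>'" and "normalized J \<eta> V E \<mu>'"
    and "decreasing J V \<mu>'" and "markovian J V E \<mu>'"
  shows "\<forall>S. S \<subseteq> V \<longrightarrow> \<mu> S = \<mu>' S"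
proof (intro allI impI)
  obtain \<nu> where F: "normalized_triangle_free_family J V E \<mu> \<nu> \<eta>"
    by (rule markovian_versions[OF assms(1-5,7)])
  obtain \<nu>' where G: "normalized_triangle_free_family J V E \<mu>' \<nu>' \<eta>"
    by (rule markovian_versions[OF assms(1-3,8,9,11)])
  fix S assume "S \<subseteq> V"
  then have "finite S"
    using assms(2) finite_subset unfolding simple_graph_def by blast
  then show "\<mu> S = \<mu>' S"
    using \<open>S \<subseteq> V\<close>
  proof (induction S rule: finite_psubset_induct)
    case (psubset S)
    show ?case
    proof (cases "\<exists>i\<in>S. \<exists>j\<in>S. i \<noteq> j \<and> {i, j} \<notin> E")
      case True
      then obtain i j where ij: "i \<in> S" "j \<in> S" "i \<noteq> j" "{i, j} \<notin> E" by blast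
      show ?thesis
      proof (rule markov_step_unique[OF F G psubset.prems ij])
        show "\<mu> R = \<mu>' R" if "R \<subset> S" for R
          using psubset.IH[OF that] that psubset.prems by simp
      qed
    next
      case False
      show ?thesis
      proof (rule clique_unique[OF F G psubset.prems])
        show "{i, j} \<in> E" if "i \<in> S" "j \<in> S" "i \<noteq> j" for i j
          using False that by blast
      qed
    qed
  qed
qed

end
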